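(* Let $M$ be a manifold which contains a countably compact non-compact subspace. Then $M$ is not homotopy equivalent to a CW-complex.
   Context: A manifold is a connected Hausdorff space each of whose points has a neighborhood homeomorphic to $\mathbb{R}^n$ for some finite $n\ge 1$. No second countability or metrizability is assumed. The subspace is not assumed to be closed in $M$. *)

theory Defs
  imports "HOL-Analysis.Analysis"
begin

(* No second countability; the dimension may a priori depend on the point. The neighbourhood N
   need not be open. *)
definition manifold_space :: "'a topology \<Rightarrow> bool" where
  "manifold_space M \<longleftrightarrow>
     connected_space M \<and> Hausdorff_space M \<and>
     (\<forall>x\<in>topspace M. \<exists>N n. N \<subseteq> topspace M \<and> x \<in> M interior_of N \<and> n \<ge> 1 \<and>
        subtopology M N homeomorphic_space Euclidean_space n)"

(* The abstract-topology version of countably_compact, parallel to compactin. *)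
definition countably_compactin :: "'a topology \<Rightarrow> 'a set \<Rightarrow> bool" where
  "countably_compactin X S \<longleftrightarrow>
     S \<subseteq> topspace X \<and>
     (\<forall>\<U>. countable \<U> \<and> (\<forall>U\<in>\<U>. openin X U) \<and> S \<subseteq> \<Union>\<U> \<longrightarrow>
        (\<exists>\<F>. finite \<F> \<and> \<F> \<subseteq> \<U> \<and> S \<subseteq> \<Union>\<F>))"

(* For n = 0 the closed and the open disk are both the one-point space, and the boundary sphere
   is empty. *)
definition closed_disk :: "nat \<Rightarrow> (nat \<Rightarrow> real) topology" where
  "closed_disk n = subtopology (Euclidean_space n) {x. (\<Sum>i<n. x i ^ 2) \<le> 1}"

definition open_disk :: "nat \<Rightarrow> (nat \<Rightarrow> real) topology" where
  "open_disk n = subtopology (Euclidean_space n) {x. (\<Sum>i<n. x i ^ 2) < 1}"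

definition disk_boundary :: "nat \<Rightarrow> (nat \<Rightarrow> real) set" where
  "disk_boundary n = topspace (Euclidean_space n) \<inter> {x. (\<Sum>i<n. x i ^ 2) = 1}"

(* J. H. C. Whitehead's definition. E is the set of open cells, d e the dimension of the cell e
   and \<Phi> e its characteristic map. The last two conditions are closure-finiteness and the weak
   topology. *)
definition CW_structure ::
  "'b topology \<Rightarrow> 'b set set \<Rightarrow> ('b set \<Rightarrow> nat) \<Rightarrow> ('b set \<Rightarrow> (nat \<Rightarrow> real) \<Rightarrow> 'b) \<Rightarrow> bool" where
  "CW_structure X E d \<Phi> \<longleftrightarrow>
     Hausdorff_space X \<and>
     disjoint E \<and> \<Union>E = topspace X \<and>
     (\<forall>e\<in>E. continuous_map (closed_disk (d e)) X (\<Phi> e) \<and>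
        homeomorphic_map (open_disk (d e)) (subtopology X e) (\<Phi> e)) \<and>
     (\<forall>e\<in>E. \<exists>F. finite F \<and> F \<subseteq> {c\<in>E. d c < d e} \<and> \<Phi> e ` disk_boundary (d e) \<subseteq> \<Union>F) \<and>
     (\<forall>A. A \<subseteq> topspace X \<longrightarrow>
        (closedin X A \<longleftrightarrow> (\<forall>e\<in>E. closedin X (A \<inter> X closure_of e))))"

definition CW_complex :: "'b topology \<Rightarrow> bool" where
  "CW_complex X \<longleftrightarrow> (\<exists>E d \<Phi>. CW_structure X E d \<Phi>)"

end

theory Submission
  imports Defs
begin

text \<open>Let \<open>C\<close> be countably compact in the manifold \<open>M\<close>, let \<open>f\<close> from \<open>M\<close> to a CW complex and \<open>g\<close>
  back be homotopy inverse to each other, and let \<open>h\<close> be a homotopy from \<open>g \<circ> f\<close> to the identity.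
  Write \<open>h\<^sub>t\<close> for the map at time \<open>t\<close>. A countably compact subset of a CW complex meets only
  finitely many cells and so lies in a compact set
  (\<open>CW_complex_countably_compactin_subset_compactin\<close>). Hence \<open>h\<^sub>0 ` C\<close> lies in a compact subset of
  \<open>M\<close>. Compactness is then carried along the homotopy until it reaches \<open>h\<^sub>1 ` C = C\<close>
  (\<open>manifold_homotopy_compactin\<close>).

  The quantity that is carried along is a weak form of second countability: a set \<open>W\<close> is countably
  separated if countably many closed sets of the whole space suffice to separate each point of \<open>W\<close>
  from every other point of the space. Charts have this property, hence every compact subset of \<open>M\<close>
  has an open neighbourhood with this property. Consider the times \<open>t\<close> at which \<open>h\<^sub>t ` C\<close> lies in a
  countably separated open set. Countable compactness of \<open>C\<close> gives a tube lemma
  (\<open>homotopy_stays_in_open\<close>), so these times form an open set.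

  That they form a closed set is the main point. An open set that contains \<open>h\<^sub>s ` C\<close> at earlier times
  \<open>s\<close> may have a closure that is far from second countable, so the limit stage cannot be controlled
  from its position in \<open>M\<close>. Instead one works in \<open>C\<close>: the values of \<open>h\<close> at a sequence of times
  tending to \<open>t\<close> determine the value at \<open>t\<close>, so countably many closed subsets of \<open>C\<close> separate the
  fibres of \<open>h\<^sub>t\<close>. For a countably compact \<open>C\<close> this alone forces \<open>h\<^sub>t ` C\<close> to be compact
  (\<open>compactin_image_if_fibres_separated\<close>).\<close>

section \<open>Countably compact sets\<close>

lemma countably_compactin_continuous_image:
  assumes C: "countably_compactin X C" and f: "continuous_map X Y f"
  shows "countably_compactin Y (f ` C)"
  unfolding countably_compactin_def
proof (intro conjI allI impI)
  show "f ` C \<subseteq> topspace Y"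
    using C f by (auto simp: countably_compactin_def continuous_map_def)
next
  fix \<U> assume \<U>: "countable \<U> \<and> (\<forall>U\<in>\<U>. openin Y U) \<and> f ` C \<subseteq> \<Union>\<U>"
  let ?pre = "\<lambda>U. {x \<in> topspace X. f x \<in> U}"
  have "countable (?pre ` \<U>)" "\<forall>V\<in>?pre ` \<U>. openin X V"
    using \<U> openin_continuous_map_preimage[OF f] by auto
  moreover have "C \<subseteq> \<Union>(?pre ` \<U>)"
    using \<U> C by (fastforce simp: countably_compactin_def)
  ultimately obtain \<F> where \<F>: "finite \<F>" "\<F> \<subseteq> ?pre ` \<U>" "C \<subseteq> \<Union>\<F>"
    using C unfolding countably_compactin_def by meson
  then obtain \<G> where "\<G> \<subseteq> \<U>" "finite \<G>" "\<F> = ?pre ` \<G>"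
    by (meson finite_subset_image)
  with \<F> show "\<exists>\<F>. finite \<F> \<and> \<F> \<subseteq> \<U> \<and> f ` C \<subseteq> \<Union>\<F>"
    by (intro exI[of _ \<G>]) blast
qed

lemma countably_compactin_increasing_cover:
  fixes V :: "nat \<Rightarrow> 'a set"
  assumes C: "countably_compactin X C"
    and V: "\<And>n. openin X (V n)" "\<And>m n. m \<le> n \<Longrightarrow> V m \<subseteq> V n"
    and cover: "C \<subseteq> (\<Union>n. V n)"
  obtains n where "C \<subseteq> V n"
proof -
  have "countable (range V) \<and> (\<forall>U\<in>range V. openin X U) \<and> C \<subseteq> \<Union>(range V)"
    using V(1) cover by auto
  then obtain \<F> where "finite \<F>" "\<F> \<subseteq> range V" "C \<subseteq> \<Union>\<F>"
    using C unfolding countably_compactin_def by meson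
  then obtain N where N: "finite N" "\<F> = V ` N"
    by (meson finite_subset_image)
  have "C \<subseteq> V (Max (insert 0 N))"
  proof
    fix x assume "x \<in> C"
    then obtain n where "n \<in> N" "x \<in> V n"
      using \<open>C \<subseteq> \<Union>\<F>\<close> N by auto
    then show "x \<in> V (Max (insert 0 N))"
      using V(2)[of n "Max (insert 0 N)"] N(1) by auto
  qed
  then show thesis by (rule that)
qed

lemma countably_compactin_closed_Inter:
  assumes C: "countably_compactin X C"
    and \<F>: "countable \<F>" "\<And>F. F \<in> \<F> \<Longrightarrow> closedin X F"
    and V: "openin X V" "C \<inter> \<Inter>\<F> \<subseteq> V"
  obtains \<G> where "finite \<G>" "\<G> \<subseteq> \<F>" "C \<inter> \<Inter>\<G> \<subseteq> V"
proof -
  let ?comp = "\<lambda>F. topspace X - F"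
  let ?\<U> = "insert V (?comp ` \<F>)"
  have Csub: "C \<subseteq> topspace X"
    using C by (simp add: countably_compactin_def)
  have "countable ?\<U> \<and> (\<forall>U\<in>?\<U>. openin X U) \<and> C \<subseteq> \<Union>?\<U>"
    using \<F> V Csub by auto
  then obtain \<H> where \<H>: "finite \<H>" "\<H> \<subseteq> ?\<U>" "C \<subseteq> \<Union>\<H>"
    using C unfolding countably_compactin_def by meson
  then have "finite (\<H> - {V})" "\<H> - {V} \<subseteq> ?comp ` \<F>"
    by auto
  then obtain \<G> where \<G>: "\<G> \<subseteq> \<F>" "finite \<G>" "\<H> - {V} = ?comp ` \<G>"
    by (meson finite_subset_image)
  have "C \<inter> \<Inter>\<G> \<subseteq> V"
  proof
    fix x assume x: "x \<in> C \<inter> \<Inter>\<G>"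
    then obtain H where "H \<in> \<H>" "x \<in> H"
      using \<H> by auto
    moreover have "H \<notin> ?comp ` \<G>"
      using x \<open>x \<in> H\<close> by auto
    ultimately show "x \<in> V"
      using \<G>(3) by auto
  qed
  with \<G> show thesis by (intro that)
qed

text \<open>This criterion replaces second countability. If \<open>U\<close> is open around \<open>f x\<close>, then the
  members of \<open>\<B>\<close> containing \<open>x\<close> intersect, inside \<open>C\<close>, within the fibre of \<open>f x\<close>, so by countable
  compactness finitely many of them already intersect within the preimage of \<open>U\<close>. There are only
  countably many finite subfamilies of \<open>\<B>\<close>, hence every open cover of \<open>f ` C\<close> has a countable
  subcover, and countable compactness finishes the argument.\<close>

lemma compactin_image_if_fibres_separated:
  assumes C: "countably_compactin X C" and f: "continuous_map X Y f"
    and \<B>: "countable \<B>" "\<And>B. B \<in> \<B> \<Longrightarrow> closedin X B"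
    and sep: "\<And>x y. \<lbrakk>x \<in> C; y \<in> C; f x \<noteq> f y\<rbrakk> \<Longrightarrow> \<exists>B\<in>\<B>. x \<in> B \<and> y \<notin> B"
  shows "compactin Y (f ` C)"
  unfolding compactin_def
proof (intro conjI allI impI)
  have fC: "countably_compactin Y (f ` C)"
    by (rule countably_compactin_continuous_image[OF C f])
  then show "f ` C \<subseteq> topspace Y"
    by (simp add: countably_compactin_def)
  fix \<U> assume \<U>: "(\<forall>U\<in>\<U>. openin Y U) \<and> f ` C \<subseteq> \<Union>\<U>"
  define I where "I = {\<G>. finite \<G> \<and> \<G> \<subseteq> \<B> \<and> (\<exists>U\<in>\<U>. f ` (C \<inter> \<Inter>\<G>) \<subseteq> U)}"
  have "countable I"
    by (rule countable_subset[OF _ countable_Collect_finite_subset[OF \<B>(1)]]) (auto simp: I_def)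
  have "\<forall>\<G>\<in>I. \<exists>U. U \<in> \<U> \<and> f ` (C \<inter> \<Inter>\<G>) \<subseteq> U"
    by (auto simp: I_def)
  then obtain u where u: "\<And>\<G>. \<G> \<in> I \<Longrightarrow> u \<G> \<in> \<U> \<and> f ` (C \<inter> \<Inter>\<G>) \<subseteq> u \<G>"
    by metis
  have "f x \<in> \<Union>(u ` I)" if x: "x \<in> C" for x
  proof -
    obtain U where U: "U \<in> \<U>" "f x \<in> U"
      using \<U> x by auto
    let ?V = "{y \<in> topspace X. f y \<in> U}"
    let ?\<F> = "{B \<in> \<B>. x \<in> B}"
    have V: "openin X ?V"
      using \<U> U openin_continuous_map_preimage[OF f] by auto
    have sub: "C \<inter> \<Inter>?\<F> \<subseteq> ?V"
    proof
      fix y assume y: "y \<in> C \<inter> \<Inter>?\<F>"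
      then have "f x = f y"
        using sep[of x y] x by auto
      then show "y \<in> ?V"
        using y U C by (auto simp: countably_compactin_def)
    qed
    have cnt: "countable ?\<F>"
      using \<B>(1) by simp
    have cl: "\<And>B. B \<in> ?\<F> \<Longrightarrow> closedin X B"
      using \<B>(2) by blast
    obtain \<G> where \<G>: "finite \<G>" "\<G> \<subseteq> ?\<F>" "C \<inter> \<Inter>\<G> \<subseteq> ?V"
      by (rule countably_compactin_closed_Inter[OF C cnt cl V sub])
    then have "\<G> \<in> I"
      using U by (auto simp: I_def)
    moreover have "x \<in> C \<inter> \<Inter>\<G>"
      using \<G> x by auto
    ultimately show ?thesis
      using u[of \<G>] by blast
  qed
  then have "f ` C \<subseteq> \<Union>(u ` I)" by blast
  moreover have "countable (u ` I)" "\<forall>U\<in>u ` I. openin Y U"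
    using \<open>countable I\<close> u \<U> by auto
  ultimately obtain \<F> where "finite \<F>" "\<F> \<subseteq> u ` I" "f ` C \<subseteq> \<Union>\<F>"
    using fC unfolding countably_compactin_def by meson
  then show "\<exists>\<F>. finite \<F> \<and> \<F> \<subseteq> \<U> \<and> f ` C \<subseteq> \<Union>\<F>"
    using u by (intro exI[of _ \<F>]) auto
qed

section \<open>Countable separation in manifolds\<close>

text \<open>The separating sets are closed in all of \<open>X\<close>, and \<open>q\<close> ranges over all of \<open>X\<close> rather than
  over \<open>W\<close>, so that separating families of several sets \<open>W\<close> can simply be united.\<close>

definition countably_separated :: "'a topology \<Rightarrow> 'a set \<Rightarrow> bool" where
  "countably_separated X W \<longleftrightarrow>
     (\<exists>\<B>. countable \<B> \<and> (\<forall>B\<in>\<B>. closedin X B) \<and>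
        (\<forall>p\<in>W. \<forall>q\<in>topspace X. p \<noteq> q \<longrightarrow> (\<exists>B\<in>\<B>. p \<in> B \<and> q \<notin> B)))"

lemma countably_separated_mono:
  assumes "countably_separated X W" "V \<subseteq> W"
  shows "countably_separated X V"
proof -
  obtain \<B> where \<B>: "countable \<B>" "\<forall>B\<in>\<B>. closedin X B"
    and sep: "\<And>p q. \<lbrakk>p \<in> W; q \<in> topspace X; p \<noteq> q\<rbrakk> \<Longrightarrow> \<exists>B\<in>\<B>. p \<in> B \<and> q \<notin> B"
    using assms(1) unfolding countably_separated_def by auto
  have "\<forall>p\<in>V. \<forall>q\<in>topspace X. p \<noteq> q \<longrightarrow> (\<exists>B\<in>\<B>. p \<in> B \<and> q \<notin> B)"
    using sep assms(2) by (intro ballI impI) (simp add: subset_iff)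
  with \<B> show ?thesis
    unfolding countably_separated_def by (intro exI[of _ \<B>] conjI)
qed

lemma countably_separated_Union:
  assumes "countable \<W>" "\<And>W. W \<in> \<W> \<Longrightarrow> countably_separated X W"
  shows "countably_separated X (\<Union>\<W>)"
proof -
  have "\<forall>W\<in>\<W>. \<exists>\<B>. countable \<B> \<and> (\<forall>B\<in>\<B>. closedin X B) \<and>
        (\<forall>p\<in>W. \<forall>q\<in>topspace X. p \<noteq> q \<longrightarrow> (\<exists>B\<in>\<B>. p \<in> B \<and> q \<notin> B))"
    using assms(2) by (simp add: countably_separated_def)
  then obtain \<B> where \<B>: "\<And>W. W \<in> \<W> \<Longrightarrow> countable (\<B> W) \<and> (\<forall>B\<in>\<B> W. closedin X B) \<and>
        (\<forall>p\<in>W. \<forall>q\<in>topspace X. p \<noteq> q \<longrightarrow> (\<exists>B\<in>\<B> W. p \<in> B \<and> q \<notin> B))"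
    by metis
  show ?thesis
    unfolding countably_separated_def
  proof (intro exI[of _ "\<Union>W\<in>\<W>. \<B> W"] conjI)
    show "countable (\<Union>W\<in>\<W>. \<B> W)"
      using assms(1) \<B> by blast
    show "\<forall>B\<in>\<Union>W\<in>\<W>. \<B> W. closedin X B"
      using \<B> by blast
    show "\<forall>p\<in>\<Union>\<W>. \<forall>q\<in>topspace X. p \<noteq> q \<longrightarrow> (\<exists>B\<in>\<Union>W\<in>\<W>. \<B> W. p \<in> B \<and> q \<notin> B)"
    proof (intro ballI impI)
      fix p q assume "p \<in> \<Union>\<W>" and q: "q \<in> topspace X" "p \<noteq> q"
      then obtain W where W: "W \<in> \<W>" "p \<in> W" by blast
      then obtain B where "B \<in> \<B> W" "p \<in> B" "q \<notin> B"
        using \<B>[OF W(1)] q by blast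
      with W(1) show "\<exists>B\<in>\<Union>W\<in>\<W>. \<B> W. p \<in> B \<and> q \<notin> B" by blast
    qed
  qed
qed

lemma compactin_Euclidean_space_cube:
  "compactin (Euclidean_space n) {x. (\<forall>i\<ge>n. x i = 0) \<and> (\<forall>i<n. \<bar>x i\<bar> \<le> m)}"
proof -
  let ?I = "\<lambda>i. if i < n then {-m..m} else {0::real}"
  have "{x. (\<forall>i\<ge>n. x i = 0) \<and> (\<forall>i<n. \<bar>x i\<bar> \<le> m)} = PiE UNIV ?I"
    by (auto simp: PiE_iff abs_le_iff linorder_not_less split: if_splits) (smt (verit) not_le)+
  moreover have "compactin (powertop_real UNIV) (PiE UNIV ?I)"
    by (simp add: compactin_PiE)
  ultimately show ?thesis
    by (auto simp: Euclidean_space_def compactin_subtopology)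
qed

text \<open>Two distinct points differ in some coordinate, and a half-space with rational bound in that
  coordinate separates them; intersecting with a large cube makes it compact. The cubes themselves
  belong to the family so that it covers the space also in dimension 0.\<close>

lemma Euclidean_space_compact_separation:
  obtains \<K> where "countable \<K>" "\<And>K. K \<in> \<K> \<Longrightarrow> compactin (Euclidean_space n) K"
    "topspace (Euclidean_space n) \<subseteq> \<Union>\<K>"
    "\<And>p q. \<lbrakk>p \<in> topspace (Euclidean_space n); q \<in> topspace (Euclidean_space n); p \<noteq> q\<rbrakk>
       \<Longrightarrow> \<exists>K\<in>\<K>. p \<in> K \<and> q \<notin> K"
proof -
  define Q where "Q m = {x. (\<forall>i\<ge>n. x i = 0) \<and> (\<forall>i<n. \<bar>x i\<bar> \<le> real m)}" for m
  define L where "L = (\<lambda>(m, j, r). Q m \<inter> {x. x j \<le> real_of_rat r})"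
  define R where "R = (\<lambda>(m, j, r). Q m \<inter> {x. x j \<ge> real_of_rat r})"
  have Q: "compactin (Euclidean_space n) (Q m)" for m
    unfolding Q_def by (rule compactin_Euclidean_space_cube)
  have slab: "compactin (Euclidean_space n) (Q m \<inter> S)" if "closed S" for m S
  proof (rule closed_compactin[OF Q])
    have "closedin (Euclidean_space n) (S \<inter> topspace (Euclidean_space n))"
      using that closedin_Euclidean_space_iff[of n "topspace (Euclidean_space n)"]
      by (auto simp: closedin_Euclidean_space_iff)
    moreover have "closedin (Euclidean_space n) (Q m)"
      using Q by (intro compactin_imp_closedin)
        (auto simp: Euclidean_space_def Hausdorff_space_subtopology Hausdorff_space_product_topology)
    ultimately have "closedin (Euclidean_space n) (Q m \<inter> (S \<inter> topspace (Euclidean_space n)))"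
      by blast
    moreover have "Q m \<inter> (S \<inter> topspace (Euclidean_space n)) = Q m \<inter> S"
      using compactin_subset_topspace[OF Q] by blast
    ultimately show "closedin (Euclidean_space n) (Q m \<inter> S)" by simp
  qed auto
  have bounded: "\<exists>m. p \<in> Q m" if p: "p \<in> topspace (Euclidean_space n)" for p
  proof -
    obtain m :: nat where m: "(\<Sum>i<n. \<bar>p i\<bar>) \<le> real m"
      using real_arch_simple by blast
    have "\<bar>p i\<bar> \<le> (\<Sum>i<n. \<bar>p i\<bar>)" if "i < n" for i
      using that by (intro member_le_sum) auto
    then show ?thesis
      using p m by (intro exI[of _ m]) (force simp: Q_def topspace_Euclidean_space)
  qed
  show thesis
  proof (rule that[of "range Q \<union> range L \<union> range R"])
    show "countable (range Q \<union> range L \<union> range R)"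
      by simp
    have "closed {x::nat \<Rightarrow> real. x j \<le> r}" "closed {x::nat \<Rightarrow> real. x j \<ge> r}" for j r
      by (intro closed_Collect_le continuous_intros continuous_on_product_coordinates)+
    then show "compactin (Euclidean_space n) K" if "K \<in> range Q \<union> range L \<union> range R" for K
      using that Q slab by (auto simp: L_def R_def)
    show "topspace (Euclidean_space n) \<subseteq> \<Union>(range Q \<union> range L \<union> range R)"
      using bounded by blast
    fix p q assume p: "p \<in> topspace (Euclidean_space n)" and "p \<noteq> q"
    then obtain j where j: "p j \<noteq> q j" by blast
    obtain m where m: "p \<in> Q m" using bounded[OF p] by blast
    show "\<exists>K\<in>range Q \<union> range L \<union> range R. p \<in> K \<and> q \<notin> K"
    proof (cases "p j < q j")
      case True
      then obtain r where "p j < real_of_rat r" "real_of_rat r < q j"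
        using of_rat_dense by blast
      then have "p \<in> L (m, j, r)" "q \<notin> L (m, j, r)"
        using m by (auto simp: L_def)
      then show ?thesis by blast
    next
      case False
      then obtain r where "q j < real_of_rat r" "real_of_rat r < p j"
        using of_rat_dense[of "q j" "p j"] j by auto
      then have "p \<in> R (m, j, r)" "q \<notin> R (m, j, r)"
        using m by (auto simp: R_def)
      then show ?thesis by blast
    qed
  qed
qed

text \<open>The separating sets are compact in the chart, so their images are closed in the whole
  Hausdorff space. A point outside the chart is missed by all of them.\<close>

lemma countably_separated_chart:
  assumes X: "Hausdorff_space X" and N: "N \<subseteq> topspace X"
    and chart: "subtopology X N homeomorphic_space Euclidean_space n"
  shows "countably_separated X N"
proof -
  obtain \<phi> \<psi> where h: "homeomorphic_maps (subtopology X N) (Euclidean_space n) \<phi> \<psi>"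
    using chart by (auto simp: homeomorphic_space_def)
  have top: "topspace (subtopology X N) = N"
    using N by auto
  have \<psi>: "continuous_map (Euclidean_space n) (subtopology X N) \<psi>"
    and \<phi>: "\<And>x. x \<in> N \<Longrightarrow> \<phi> x \<in> topspace (Euclidean_space n)"
    and inv: "\<And>x. x \<in> N \<Longrightarrow> \<psi> (\<phi> x) = x" "\<And>y. y \<in> topspace (Euclidean_space n) \<Longrightarrow> \<phi> (\<psi> y) = y"
    using h top by (auto simp: homeomorphic_maps_def continuous_map_def)
  obtain \<K> where \<K>: "countable \<K>" "\<And>K. K \<in> \<K> \<Longrightarrow> compactin (Euclidean_space n) K"
    "topspace (Euclidean_space n) \<subseteq> \<Union>\<K>"
    "\<And>p q. \<lbrakk>p \<in> topspace (Euclidean_space n); q \<in> topspace (Euclidean_space n); p \<noteq> q\<rbrakk>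
       \<Longrightarrow> \<exists>K\<in>\<K>. p \<in> K \<and> q \<notin> K"
    using Euclidean_space_compact_separation by blast
  have cpt: "compactin X (\<psi> ` K)" "\<psi> ` K \<subseteq> N" if "K \<in> \<K>" for K
    using image_compactin[OF \<K>(2)[OF that] \<psi>] by (auto simp: compactin_subtopology)
  have mem: "x \<in> \<psi> ` K \<longleftrightarrow> \<phi> x \<in> K" if "x \<in> N" "K \<in> \<K>" for x K
    using that inv compactin_subset_topspace[OF \<K>(2)] by force
  show ?thesis
    unfolding countably_separated_def
  proof (intro exI[of _ "(`) \<psi> ` \<K>"] conjI ballI impI)
    show "countable ((`) \<psi> ` \<K>)"
      using \<K>(1) by simp
    show "closedin X B" if "B \<in> (`) \<psi> ` \<K>" for B
      using that cpt(1) compactin_imp_closedin[OF X] by auto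
    fix p q assume p: "p \<in> N" and q: "q \<in> topspace X" "p \<noteq> q"
    have "\<exists>K\<in>\<K>. \<phi> p \<in> K \<and> (q \<in> N \<longrightarrow> \<phi> q \<notin> K)"
    proof (cases "q \<in> N")
      case True
      then have "\<phi> p \<noteq> \<phi> q"
        using inv(1) p q by metis
      then show ?thesis
        using \<K>(4)[OF \<phi> \<phi>] p True by blast
    next
      case False
      then show ?thesis
        using \<K>(3) \<phi>[OF p] by blast
    qed
    then obtain K where K: "K \<in> \<K>" "\<phi> p \<in> K" "q \<in> N \<longrightarrow> \<phi> q \<notin> K" by blast
    have "p \<in> \<psi> ` K"
      using mem[OF p K(1)] K(2) by simp
    moreover have "q \<notin> \<psi> ` K"
      using mem[OF _ K(1)] K(3) cpt(2)[OF K(1)] by blast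
    ultimately show "\<exists>B\<in>(`) \<psi> ` \<K>. p \<in> B \<and> q \<notin> B"
      using K(1) by blast
  qed
qed

lemma manifold_compactin_countably_separated:
  assumes M: "manifold_space M" and K: "compactin M K"
  obtains W where "openin M W" "K \<subseteq> W" "countably_separated M W"
proof -
  let ?\<U> = "{U. openin M U \<and> countably_separated M U}"
  have "x \<in> \<Union>?\<U>" if "x \<in> topspace M" for x
  proof -
    from M that have "\<exists>N n. N \<subseteq> topspace M \<and> x \<in> M interior_of N \<and> n \<ge> 1 \<and>
        subtopology M N homeomorphic_space Euclidean_space n"
      unfolding manifold_space_def by simp
    then obtain N n where N: "N \<subseteq> topspace M" "x \<in> M interior_of N"
      "subtopology M N homeomorphic_space Euclidean_space n"
      by blast
    then have "countably_separated M N"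
      using M countably_separated_chart unfolding manifold_space_def by blast
    then have "countably_separated M (M interior_of N)"
      by (rule countably_separated_mono) (rule interior_of_subset)
    then show ?thesis
      using N(2) openin_interior_of by blast
  qed
  then have "K \<subseteq> \<Union>?\<U>"
    using compactin_subset_topspace[OF K] by blast
  then obtain \<F> where \<F>: "finite \<F>" "\<F> \<subseteq> ?\<U>" "K \<subseteq> \<Union>\<F>"
    using K unfolding compactin_def by (metis (no_types, lifting) mem_Collect_eq)
  show thesis
  proof
    show "openin M (\<Union>\<F>)"
      using \<F> by (intro openin_Union) auto
    show "K \<subseteq> \<Union>\<F>" by fact
    show "countably_separated M (\<Union>\<F>)"
      using \<F> by (intro countably_separated_Union) (auto simp: countable_finite)
  qed
qed

section \<open>Moving a countably compact set by a homotopy\<close>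

lemma homotopy_slice_continuous:
  assumes h: "continuous_map (prod_topology (top_of_set {0..1::real}) X) Y h" and t: "t \<in> {0..1}"
  shows "continuous_map X Y (\<lambda>x. h (t, x))"
proof -
  have "continuous_map X (prod_topology (top_of_set {0..1::real}) X) (\<lambda>x. (t, x))"
    using t by (simp add: continuous_map_pairwise o_def)
  from continuous_map_compose[OF this h] show ?thesis
    by (simp add: o_def)
qed

text \<open>For each point of \<open>C\<close> some time interval of length \<open>1/n\<close> and some neighbourhood work
  together; the union of the neighbourhoods belonging to a given \<open>n\<close> increases with \<open>n\<close>, so
  countable compactness makes one \<open>n\<close> serve all of \<open>C\<close>.\<close>

lemma homotopy_stays_in_open:
  assumes h: "continuous_map (prod_topology (top_of_set {0..1::real}) X) Y h"
    and C: "countably_compactin X C" and W: "openin Y W"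
    and t: "t \<in> {0..1}" "(\<lambda>x. h (t, x)) ` C \<subseteq> W"
  obtains e where "e > 0" "\<And>s. \<lbrakk>s \<in> {0..1}; \<bar>s - t\<bar> < e\<rbrakk> \<Longrightarrow> (\<lambda>x. h (s, x)) ` C \<subseteq> W"
proof -
  define good where "good n U \<longleftrightarrow> openin X U \<and>
    (\<forall>s\<in>{0..1}. \<forall>x\<in>U. \<bar>s - t\<bar> < 1 / real (Suc n) \<longrightarrow> h (s, x) \<in> W)" for n U
  have "C \<subseteq> (\<Union>n. \<Union>{U. good n U})"
  proof
    fix x assume x: "x \<in> C"
    let ?P = "{z \<in> topspace (prod_topology (top_of_set {0..1::real}) X). h z \<in> W}"
    have "openin (prod_topology (top_of_set {0..1::real}) X) ?P"
      by (rule openin_continuous_map_preimage[OF h W])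
    moreover have "(t, x) \<in> ?P"
      using x t C by (auto simp: countably_compactin_def)
    ultimately obtain T U where TU: "openin (top_of_set {0..1::real}) T" "openin X U"
      "t \<in> T" "x \<in> U" "T \<times> U \<subseteq> ?P"
      unfolding openin_prod_topology_alt by meson
    then obtain e where e: "e > 0" "\<And>s. \<lbrakk>s \<in> {0..1}; dist s t < e\<rbrakk> \<Longrightarrow> s \<in> T"
      unfolding openin_euclidean_subtopology_iff by metis
    obtain n where n: "1 / real (Suc n) < e"
      using reals_Archimedean[OF e(1)] by (auto simp: inverse_eq_divide)
    have "h (s, y) \<in> W" if "s \<in> {0..1}" "y \<in> U" "\<bar>s - t\<bar> < 1 / real (Suc n)" for s y
      using e(2)[of s] that n TU(5) by (auto simp: dist_real_def)
    then have "good n U"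
      using TU(2) by (simp add: good_def)
    then show "x \<in> (\<Union>n. \<Union>{U. good n U})"
      using TU(4) by blast
  qed
  moreover have "openin X (\<Union>{U. good n U})" for n
    by (rule openin_Union) (auto simp: good_def)
  moreover have "\<Union>{U. good m U} \<subseteq> \<Union>{U. good n U}" if "m \<le> n" for m n
  proof -
    have "1 / real (Suc n) \<le> 1 / real (Suc m)"
      using that by (simp add: frac_le)
    then have "good m U \<Longrightarrow> good n U" for U
      unfolding good_def by (meson less_le_trans)
    then show ?thesis by blast
  qed
  ultimately obtain n where n: "C \<subseteq> \<Union>{U. good n U}"
    using countably_compactin_increasing_cover[OF C, of "\<lambda>n. \<Union>{U. good n U}"] by metis
  show thesis
  proof
    show "1 / real (Suc n) > 0" by simp
    show "(\<lambda>x. h (s, x)) ` C \<subseteq> W" if "s \<in> {0..1}" "\<bar>s - t\<bar> < 1 / real (Suc n)" for s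
      using n that unfolding good_def by blast
  qed
qed

text \<open>The points of a limit stage are limits of the earlier stages: two points of \<open>C\<close> with
  distinct images at time \<open>t\<close> have distinct images at some time \<open>\<tau> n\<close>, because limits in a
  Hausdorff space are unique. So the preimages of the separating sets at all the times \<open>\<tau> n\<close>
  together separate the fibres at time \<open>t\<close>.\<close>

lemma homotopy_limit_compactin:
  assumes h: "continuous_map (prod_topology (top_of_set {0..1::real}) X) Y h"
    and C: "countably_compactin X C" and Y: "Hausdorff_space Y"
    and \<tau>: "\<And>n. \<tau> n \<in> {0..1}" "\<tau> \<longlonglongrightarrow> t" and t: "t \<in> {0..1}"
    and sep: "\<And>n::nat. countably_separated Y ((\<lambda>x. h (\<tau> n, x)) ` C)"
  shows "compactin Y ((\<lambda>x. h (t, x)) ` C)"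
proof -
  note slice = homotopy_slice_continuous[OF h]
  have CX: "C \<subseteq> topspace X"
    using C by (simp add: countably_compactin_def)
  have hY: "h (s, x) \<in> topspace Y" if "s \<in> {0..1}" "x \<in> C" for s x
    using slice[OF that(1)] that(2) CX by (auto simp: continuous_map_def)
  have "\<forall>n. \<exists>\<B>. countable \<B> \<and> (\<forall>B\<in>\<B>. closedin Y B) \<and>
     (\<forall>p\<in>(\<lambda>x. h (\<tau> n, x)) ` C. \<forall>q\<in>topspace Y. p \<noteq> q \<longrightarrow> (\<exists>B\<in>\<B>. p \<in> B \<and> q \<notin> B))"
    using sep by (simp add: countably_separated_def)
  then obtain \<B> where \<B>: "\<And>n. countable (\<B> n)" "\<And>n B. B \<in> \<B> n \<Longrightarrow> closedin Y B"
    "\<And>n p q. \<lbrakk>p \<in> (\<lambda>x. h (\<tau> n, x)) ` C; q \<in> topspace Y; p \<noteq> q\<rbrakk> \<Longrightarrow> \<exists>B\<in>\<B> n. p \<in> B \<and> q \<notin> B"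
    by metis
  define pre where "pre n B = {x \<in> topspace X. h (\<tau> n, x) \<in> B}" for n B
  show ?thesis
  proof (rule compactin_image_if_fibres_separated[OF C slice[OF t], of "\<Union>n. pre n ` \<B> n"])
    show "countable (\<Union>n. pre n ` \<B> n)"
      using \<B>(1) by simp
    show "closedin X B" if "B \<in> (\<Union>n. pre n ` \<B> n)" for B
      using that \<B>(2) closedin_continuous_map_preimage[OF slice[OF \<tau>(1)]] by (auto simp: pre_def)
    fix x y assume xy: "x \<in> C" "y \<in> C" and neq: "h (t, x) \<noteq> h (t, y)"
    have lim: "limitin Y (\<lambda>n. h (\<tau> n, z)) (h (t, z)) sequentially" if "z \<in> C" for z
    proof -
      have "continuous_map (top_of_set {0..1::real}) (prod_topology (top_of_set {0..1}) X) (\<lambda>s. (s, z))"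
        using that CX by (auto simp: continuous_map_pairwise o_def id_def[symmetric])
      from continuous_map_compose[OF this h]
      have "continuous_map (top_of_set {0..1::real}) Y (\<lambda>s. h (s, z))"
        by (simp add: o_def)
      moreover have "limitin (top_of_set {0..1::real}) \<tau> t sequentially"
        using \<tau> t by (simp add: limitin_subtopology)
      ultimately show ?thesis
        using continuous_map_limit[of _ Y "\<lambda>s. h (s, z)" \<tau> t] by (simp add: o_def)
    qed
    obtain n where n: "h (\<tau> n, x) \<noteq> h (\<tau> n, y)"
    proof (rule ccontr)
      assume "\<not> thesis"
      then have "(\<lambda>n. h (\<tau> n, x)) = (\<lambda>n. h (\<tau> n, y))"
        using that by blast
      then have "limitin Y (\<lambda>n. h (\<tau> n, x)) (h (t, y)) sequentially"
        using lim[OF xy(2)] by simp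
      then show False
        using limitin_Hausdorff_unique[OF lim[OF xy(1)] _ _ Y] neq by simp
    qed
    then obtain B where "B \<in> \<B> n" "h (\<tau> n, x) \<in> B" "h (\<tau> n, y) \<notin> B"
      using \<B>(3)[of "h (\<tau> n, x)" n "h (\<tau> n, y)"] xy hY[OF \<tau>(1)] by auto
    then show "\<exists>B\<in>\<Union>n. pre n ` \<B> n. x \<in> B \<and> y \<notin> B"
      using xy CX by (intro bexI[of _ "pre n B"]) (auto simp: pre_def)
  qed
qed

text \<open>The times at which the image of \<open>C\<close> lies in a countably separated open set form a nonempty
  open and closed subset of the unit interval. The image at a limit time is compact, hence so is
  the image at time 1, which is the limit of a constant sequence of such times.\<close>

lemma manifold_homotopy_compactin:
  assumes M: "manifold_space M" and C: "countably_compactin X C"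
    and h: "continuous_map (prod_topology (top_of_set {0..1::real}) X) M h"
    and K: "compactin M K" "(\<lambda>x. h (0, x)) ` C \<subseteq> K"
  shows "compactin M ((\<lambda>x. h (1, x)) ` C)"
proof -
  have Haus: "Hausdorff_space M"
    using M by (simp add: manifold_space_def)
  define S where "S = {t \<in> {0..1::real}. \<exists>W. openin M W \<and> (\<lambda>x. h (t, x)) ` C \<subseteq> W \<and> countably_separated M W}"
  have limit: "l \<in> {0..1}" "compactin M ((\<lambda>x. h (l, x)) ` C)"
    if \<tau>: "\<And>n. \<tau> n \<in> S" "\<tau> \<longlonglongrightarrow> l" for \<tau> :: "nat \<Rightarrow> real" and l
  proof -
    have \<tau>01: "\<tau> n \<in> {0..1}" for n
      using \<tau>(1) by (simp add: S_def)
    show l: "l \<in> {0..1}"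
      using closed_sequentially[OF closed_atLeastAtMost \<tau>01 \<tau>(2)] .
    have "countably_separated M ((\<lambda>x. h (\<tau> n, x)) ` C)" for n
      using \<tau>(1)[of n] countably_separated_mono by (auto simp: S_def)
    then show "compactin M ((\<lambda>x. h (l, x)) ` C)"
      by (rule homotopy_limit_compactin[OF h C Haus \<tau>01 \<tau>(2) l])
  qed
  have "closed S"
    unfolding closed_sequential_limits
  proof (intro allI impI)
    fix \<tau> l assume "(\<forall>n. \<tau> n \<in> S) \<and> \<tau> \<longlonglongrightarrow> l"
    then have "l \<in> {0..1}" "compactin M ((\<lambda>x. h (l, x)) ` C)"
      using limit by blast+
    then show "l \<in> S"
      using manifold_compactin_countably_separated[OF M] by (metis (mono_tags, lifting) S_def mem_Collect_eq)
  qed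
  then have "closedin (top_of_set {0..1}) S"
    by (intro closed_subset) (auto simp: S_def)
  moreover have "openin (top_of_set {0..1}) S"
    unfolding openin_euclidean_subtopology_iff
  proof (intro conjI ballI)
    show "S \<subseteq> {0..1}" by (auto simp: S_def)
    fix t assume "t \<in> S"
    then obtain W where W: "t \<in> {0..1}" "openin M W" "(\<lambda>x. h (t, x)) ` C \<subseteq> W" "countably_separated M W"
      by (auto simp: S_def)
    obtain e where "e > 0" "\<And>s. \<lbrakk>s \<in> {0..1}; \<bar>s - t\<bar> < e\<rbrakk> \<Longrightarrow> (\<lambda>x. h (s, x)) ` C \<subseteq> W"
      using homotopy_stays_in_open[OF h C W(2,1,3)] by blast
    then show "\<exists>e>0. \<forall>s\<in>{0..1}. dist s t < e \<longrightarrow> s \<in> S"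
      using W unfolding S_def dist_real_def by blast
  qed
  moreover have "0 \<in> S"
    using manifold_compactin_countably_separated[OF M K(1)] K(2) unfolding S_def by fastforce
  ultimately have "S = {0..1}"
    using connected_clopen[of "{0..1::real}"] by auto
  then have "\<And>n::nat. 1 \<in> S" by simp
  then show ?thesis
    using limit(2)[of "\<lambda>n. 1" 1] by simp
qed

section \<open>Countably compact sets in CW complexes\<close>

lemma compact_space_closed_disk: "compact_space (closed_disk n)"
proof -
  let ?D = "{x. (\<Sum>i<n. x i ^ 2) \<le> (1::real)}"
  have "compactin (Euclidean_space n) (topspace (Euclidean_space n) \<inter> ?D)"
  proof (rule closed_compactin[OF compactin_Euclidean_space_cube])
    show "topspace (Euclidean_space n) \<inter> ?D \<subseteq> {x. (\<forall>i\<ge>n. x i = 0) \<and> (\<forall>i<n. \<bar>x i\<bar> \<le> 1)}"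
    proof clarify
      fix x assume x: "x \<in> topspace (Euclidean_space n)" "(\<Sum>i<n. x i ^ 2) \<le> 1"
      have "x i ^ 2 \<le> 1" if "i < n" for i
        using member_le_sum[of i "{..<n}" "\<lambda>i. x i ^ 2"] that x(2) by simp
      then show "(\<forall>i\<ge>n. x i = 0) \<and> (\<forall>i<n. \<bar>x i\<bar> \<le> 1)"
        using x(1) by (auto simp: topspace_Euclidean_space abs_square_le_1)
    qed
    have "closed ?D"
      by (intro closed_Collect_le continuous_intros continuous_on_product_coordinates)
    then show "closedin (Euclidean_space n) (topspace (Euclidean_space n) \<inter> ?D)"
      using closedin_Euclidean_space_iff[of n "topspace (Euclidean_space n)"]
      by (auto simp: closedin_Euclidean_space_iff)
  qed
  then show ?thesis
    by (metis closed_disk_def compact_space_subtopology subtopology_restrict)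
qed

lemma CW_structure_cell:
  assumes CW: "CW_structure X E d \<Phi>" and e: "e \<in> E"
  shows "compactin X (\<Phi> e ` topspace (closed_disk (d e)))"
    and "e \<subseteq> \<Phi> e ` topspace (closed_disk (d e))"
    and "\<exists>F. finite F \<and> F \<subseteq> E \<and> X closure_of e \<subseteq> \<Union>F"
proof -
  have X: "Hausdorff_space X" and eX: "e \<subseteq> topspace X"
    and \<Phi>: "continuous_map (closed_disk (d e)) X (\<Phi> e)"
    and hom: "homeomorphic_map (open_disk (d e)) (subtopology X e) (\<Phi> e)"
    using CW e by (auto simp: CW_structure_def)
  have "\<forall>e\<in>E. \<exists>F. finite F \<and> F \<subseteq> {c\<in>E. d c < d e} \<and> \<Phi> e ` disk_boundary (d e) \<subseteq> \<Union>F"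
    using CW by (simp add: CW_structure_def)
  from this e have "\<exists>F. finite F \<and> F \<subseteq> {c\<in>E. d c < d e} \<and> \<Phi> e ` disk_boundary (d e) \<subseteq> \<Union>F"
    by (rule bspec)
  then obtain F where F: "finite F" "F \<subseteq> {c\<in>E. d c < d e}" "\<Phi> e ` disk_boundary (d e) \<subseteq> \<Union>F"
    by (elim exE conjE)
  have eq: "\<Phi> e ` topspace (open_disk (d e)) = e"
    using homeomorphic_imp_surjective_map[OF hom] eX by auto
  have disk: "topspace (closed_disk (d e)) = topspace (open_disk (d e)) \<union> disk_boundary (d e)"
    by (auto simp: closed_disk_def open_disk_def disk_boundary_def)
  show cpt: "compactin X (\<Phi> e ` topspace (closed_disk (d e)))"
    using image_compactin[OF _ \<Phi>] compact_space_closed_disk by (auto simp: compact_space_def)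
  show sub: "e \<subseteq> \<Phi> e ` topspace (closed_disk (d e))"
    using eq disk by auto
  have "X closure_of e \<subseteq> \<Phi> e ` topspace (closed_disk (d e))"
    by (rule closure_of_minimal[OF sub compactin_imp_closedin[OF X cpt]])
  also have "\<dots> \<subseteq> \<Union>(insert e F)"
    using eq F(3) by (auto simp: disk image_Un)
  finally show "\<exists>F. finite F \<and> F \<subseteq> E \<and> X closure_of e \<subseteq> \<Union>F"
    using F e by (intro exI[of _ "insert e F"]) auto
qed

text \<open>Each closed cell lies in finitely many cells, so a set with at most one point in each cell
  meets every closed cell in a finite, hence closed, set; the weak topology then makes it
  closed.\<close>

lemma CW_structure_transversal_closed:
  assumes CW: "CW_structure X E d \<Phi>"
    and D: "D \<subseteq> topspace X" "\<And>e x y. \<lbrakk>e \<in> E; x \<in> D \<inter> e; y \<in> D \<inter> e\<rbrakk> \<Longrightarrow> x = y"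
  shows "closedin X D"
proof -
  have X: "Hausdorff_space X"
    using CW by (simp add: CW_structure_def)
  have "closedin X (D \<inter> X closure_of e)" if e: "e \<in> E" for e
  proof -
    obtain F where F: "finite F" "F \<subseteq> E" "X closure_of e \<subseteq> \<Union>F"
      using CW_structure_cell(3)[OF CW e] by blast
    have "finite (D \<inter> c)" if "c \<in> E" for c
    proof (cases "D \<inter> c = {}")
      case False
      then obtain x where "x \<in> D \<inter> c" by blast
      then have "D \<inter> c \<subseteq> {x}"
        using D(2)[OF that] by blast
      then show ?thesis
        using finite_subset by blast
    qed simp
    then have "finite (\<Union>c\<in>F. D \<inter> c)"
      using F(1,2) by (intro finite_UN_I) auto
    then have "finite (D \<inter> X closure_of e)"
      by (rule finite_subset[rotated]) (use F(3) in auto)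
    then show ?thesis
      using X D(1) by (intro compactin_imp_closedin finite_imp_compactin) auto
  qed
  then show ?thesis
    using CW D(1) by (simp add: CW_structure_def)
qed

text \<open>Otherwise \<open>C\<close> contains a sequence of points from pairwise different cells. All its tails are
  closed, and their complements form an increasing countable open cover of \<open>C\<close> none of whose members
  contains \<open>C\<close>.\<close>

lemma CW_structure_countably_compactin_finite_cells:
  assumes CW: "CW_structure X E d \<Phi>" and C: "countably_compactin X C"
  shows "finite {e \<in> E. e \<inter> C \<noteq> {}}"
proof (rule ccontr)
  assume "infinite {e \<in> E. e \<inter> C \<noteq> {}}"
  then obtain c :: "nat \<Rightarrow> 'a set" where c: "inj c" "range c \<subseteq> {e \<in> E. e \<inter> C \<noteq> {}}"
    using infinite_countable_subset by blast
  then have "\<forall>n. \<exists>x. x \<in> c n \<inter> C" by blast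
  then obtain x where x: "\<And>n. x n \<in> c n \<inter> C" by metis
  have cE: "c n \<in> E" for n
    using c(2) by blast
  have disj: "disjoint E"
    using CW by (simp add: CW_structure_def)
  have same: "i = j" if "e \<in> E" "x i \<in> e" "x j \<in> e" for e i j
  proof -
    have "c i = e" "c j = e"
      using disjointD[OF disj cE that(1), of i] disjointD[OF disj cE that(1), of j] x that by blast+
    then show ?thesis
      using c(1) by (metis injD)
  qed
  have CX: "C \<subseteq> topspace X"
    using C by (simp add: countably_compactin_def)
  have "closedin X (x ` {n..})" for n
    using same x CX by (intro CW_structure_transversal_closed[OF CW]) blast+
  then have "openin X (topspace X - x ` {n..})" for n
    by blast
  moreover have "topspace X - x ` {m..} \<subseteq> topspace X - x ` {n..}" if "m \<le> n" for m n
    using that by auto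
  moreover have "C \<subseteq> (\<Union>n. topspace X - x ` {n..})"
  proof
    fix y assume y: "y \<in> C"
    have "\<exists>n. y \<notin> x ` {n..}"
    proof (cases "y \<in> range x")
      case True
      then obtain k where k: "y = x k" by blast
      have "y \<notin> x ` {Suc k..}"
        using k same[OF cE[of k]] x by fastforce
      then show ?thesis by blast
    qed auto
    then show "y \<in> (\<Union>n. topspace X - x ` {n..})"
      using y CX by blast
  qed
  ultimately obtain n where "C \<subseteq> topspace X - x ` {n..}"
    using countably_compactin_increasing_cover[OF C, of "\<lambda>n. topspace X - x ` {n..}"] by metis
  then show False
    using x[of n] by auto
qed

lemma CW_complex_countably_compactin_subset_compactin:
  assumes X: "CW_complex X" and C: "countably_compactin X C"
  obtains K where "compactin X K" "C \<subseteq> K"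
proof -
  obtain E d \<Phi> where CW: "CW_structure X E d \<Phi>"
    using X by (auto simp: CW_complex_def)
  let ?F = "{e \<in> E. e \<inter> C \<noteq> {}}"
  let ?K = "\<Union>e\<in>?F. \<Phi> e ` topspace (closed_disk (d e))"
  have "\<Union>E = topspace X" "C \<subseteq> topspace X"
    using C CW by (simp_all add: countably_compactin_def CW_structure_def)
  then have "C \<subseteq> \<Union>?F" by blast
  also have "\<dots> \<subseteq> ?K"
    using CW_structure_cell(2)[OF CW] by blast
  finally have "C \<subseteq> ?K" .
  moreover have "compactin X ?K"
    using CW_structure_countably_compactin_finite_cells[OF CW C] CW_structure_cell(1)[OF CW]
    by (intro compactin_Union) auto
  ultimately show thesis
    using that by blast
qed

section \<open>Homotopy type of the manifold\<close>

theorem theorem1p3: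
  fixes M :: "'a topology"
  assumes "manifold_space M"
    and "\<exists>C\<subseteq>topspace M. countably_compactin M C \<and> \<not> compactin M C"
  shows "\<not> (\<exists>X :: 'b topology. CW_complex X \<and> M homotopy_equivalent_space X)"
proof
  assume "\<exists>X :: 'b topology. CW_complex X \<and> M homotopy_equivalent_space X"
  then obtain X :: "'b topology" and f g where X: "CW_complex X"
    and f: "continuous_map M X f" and g: "continuous_map X M g"
    and "homotopic_with (\<lambda>x. True) M M (g \<circ> f) id"
    unfolding homotopy_equivalent_space_def by blast
  then obtain h where h: "continuous_map (prod_topology (top_of_set {0..1::real}) M) M h"
    "\<And>x. h (0, x) = g (f x)" "\<And>x. h (1, x) = x"
    by (auto simp: homotopic_with_def)
  obtain C where C: "countably_compactin M C" "\<not> compactin M C"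
    using assms(2) by blast
  obtain K where K: "compactin X K" "f ` C \<subseteq> K"
    using CW_complex_countably_compactin_subset_compactin[OF X]
      countably_compactin_continuous_image[OF C(1) f] by metis
  have "compactin M (g ` K)" "(\<lambda>x. h (0, x)) ` C \<subseteq> g ` K"
    using image_compactin[OF K(1) g] K(2) h(2) by auto
  from manifold_homotopy_compactin[OF assms(1) C(1) h(1) this]
  show False
    using C(2) h(3) by simp
qed

end
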